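(* Let $n\ge 1$ and $i\in[n]$. The statistic $\pi\mapsto \pi(i)$ on $S_n$ (the value of the $i$th entry of $\pi$) is $\frac{n+1}{2}$-mesic for permutations with rotation; that is, for every orbit $\mathcal{O}$ of the rotation map $rot$ on $S_n$, $\frac{1}{\#\mathcal{O}}\sum_{\pi\in\mathcal{O}}\pi(i)=\frac{n+1}{2}$.
   Context: $[n]=\{1,\dots,n\}$ and $S_n$ is the set of permutations of $[n]$, written in one-line notation $\pi=\pi(1)\pi(2)\cdots\pi(n)$. The rotation map $rot:S_n\to S_n$ sends $\pi(1)\pi(2)\cdots\pi(n)$ to $\pi(2)\cdots\pi(n)\pi(1)$. For a bijection $\varphi:S_n\to S_n$, the orbits are the sets $\mathcal{O}_\pi=\{\varphi^m(\pi)\}$ of permutations obtained by applying $\varphi$ any number of times. A statistic $st$ is $c$-mesic for $\varphi$ if $\frac{1}{\#\mathcal{O}}\sum_{x\in\mathcal{O}}st(x)=c$ for every orbit $\mathcal{O}$. *)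

theory Defs
  imports Complex_Main "HOL-Combinatorics.Permutations"
begin

definition Sym :: "nat \<Rightarrow> (nat \<Rightarrow> nat) set" where
  "Sym n = {p. p permutes {1..n}}"

text \<open>Permutations are functions on all of \<^typ>\<open>nat\<close> that are the identity outside \<open>{1..n}\<close>,
  hence the last branch. In one-line notation, \<open>rot n\<close> is \<^const>\<open>rotate1\<close>
  (lemma \<open>rot_one_line\<close>).\<close>

definition rot :: "nat \<Rightarrow> (nat \<Rightarrow> nat) \<Rightarrow> nat \<Rightarrow> nat" where
  "rot n p = (\<lambda>j. if 1 \<le> j \<and> j < n then p (j + 1) else if j = n then p 1 else j)"

text \<open>The library's \<open>HOL-Combinatorics.Orbits.orbit\<close> only collects \<open>m \<ge> 1\<close> applications; here
  \<open>m = 0\<close> is included. For a bijection of a finite set the two agree.\<close>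

definition map_orbit :: "('a \<Rightarrow> 'a) \<Rightarrow> 'a \<Rightarrow> 'a set" where
  "map_orbit f x = {(f ^^ m) x | m. True}"

text \<open>Intended for a bijection \<open>f\<close> of a finite set \<open>X\<close>, so that orbits are finite and stay
  in \<open>X\<close>; for \<open>rot n\<close> on \<open>Sym n\<close> see lemma \<open>bij_betw_rot\<close>.\<close>

definition mesic :: "'a set \<Rightarrow> ('a \<Rightarrow> 'a) \<Rightarrow> ('a \<Rightarrow> real) \<Rightarrow> real \<Rightarrow> bool" where
  "mesic X f st c \<longleftrightarrow>
     (\<forall>\<O> \<in> map_orbit f ` X. 1 / real (card \<O>) * (\<Sum>x\<in>\<O>. st x) = c)"

lemma rot_one_line:
  assumes "n \<ge> 1"
  shows "map (rot n p) [1..<Suc n] = rotate1 (map p [1..<Suc n])"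
proof (rule nth_equalityI)
  fix k assume "k < length (map (rot n p) [1..<Suc n])"
  then have k: "k < n" by (simp del: upt_Suc)
  show "map (rot n p) [1..<Suc n] ! k = rotate1 (map p [1..<Suc n]) ! k"
  proof (cases "Suc k = n")
    case True
    then show ?thesis using assms
      by (simp add: nth_rotate1 rot_def del: upt_Suc)
  next
    case False
    with k have "Suc k < n" by simp
    then show ?thesis
      by (simp add: nth_rotate1 rot_def del: upt_Suc)
  qed
qed (simp del: upt_Suc)

lemma bij_betw_rot:
  assumes "n \<ge> 1"
  shows "bij_betw (rot n) (Sym n) (Sym n)"
proof -
  define s where "s = (\<lambda>j. if 1 \<le> j \<and> j < n then j + 1 else if j = n then 1 else j)"
  have "inj_on s {1..n}"
    by (auto simp: inj_on_def s_def split: if_splits)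
  moreover have "s ` {1..n} \<subseteq> {1..n}"
    using assms by (auto simp: s_def)
  ultimately have "bij_betw s {1..n} {1..n}"
    by (simp add: bij_betw_def endo_inj_surj)
  then have s: "s permutes {1..n}"
    using assms by (intro bij_imp_permutes) (auto simp: s_def)
  have rot: "rot n p = p \<circ> s" if "p \<in> Sym n" for p
  proof
    fix j
    show "rot n p j = (p \<circ> s) j"
      using that permutes_not_in[of p "{1..n}" j]
      by (auto simp: rot_def s_def Sym_def)
  qed
  have "rot n ` Sym n \<subseteq> Sym n"
  proof
    fix q assume "q \<in> rot n ` Sym n"
    then obtain p where "p \<in> Sym n" "q = rot n p" by blast
    then show "q \<in> Sym n"
      using rot permutes_compose[OF s] by (simp add: Sym_def)
  qed
  moreover have "inj_on (rot n) (Sym n)"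
  proof (rule inj_onI)
    fix p q assume "p \<in> Sym n" "q \<in> Sym n" "rot n p = rot n q"
    then have "p \<circ> s = q \<circ> s" by (simp add: rot)
    then have "(p \<circ> s) \<circ> inv s = (q \<circ> s) \<circ> inv s" by simp
    then show "p = q"
      by (simp add: o_assoc[symmetric] permutes_inv_o[OF s])
  qed
  moreover have "finite (Sym n)"
    by (simp add: Sym_def finite_permutations)
  ultimately show ?thesis
    by (simp add: bij_betw_def endo_inj_surj)
qed

end

theory Submission
  imports Defs
begin

text \<open>Rotating \<open>m\<close> times moves into position \<open>i\<close> the entry that stood \<open>m\<close> places further along,
  counted cyclically (\<open>rot_iterate_entry\<close>). So, over one full turn, position \<open>i\<close> shows every
  value of \<open>{1..n}\<close> exactly once (\<open>bij_betw_rot_entry\<close>). In particular the \<open>n\<close> rotations met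
  during a full turn are distinct, and since the turn leads back to the start they form the whole
  orbit. The average of the entry over the orbit is therefore the average of \<open>1, \<dots>, n\<close>.\<close>

lemma rot_iterate_entry:
  assumes "j \<in> {1..n}"
  shows "(rot n ^^ m) p j = p ((j - 1 + m) mod n + 1)"
  using assms
proof (induction m arbitrary: j)
  case 0
  then show ?case by auto
next
  case (Suc m)
  show ?case
  proof (cases "j = n")
    case True
    have "(n - 1 + Suc m) mod n = m mod n"
      using Suc.prems True by simp
    then show ?thesis
      using Suc.IH[of 1] Suc.prems True by (simp add: rot_def)
  next
    case False
    then have "rot n ((rot n ^^ m) p) j = (rot n ^^ m) p (j + 1)"
      using Suc.prems by (simp add: rot_def)
    then show ?thesis
      using Suc.IH[of "j + 1"] Suc.prems False by simp
  qed
qed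

lemma rot_full_turn:
  assumes "n \<ge> 1" and "p permutes {1..n}"
  shows "(rot n ^^ n) p = p"
proof
  fix j
  show "(rot n ^^ n) p j = p j"
  proof (cases "j \<in> {1..n}")
    case True
    then have "(j - 1 + n) mod n + 1 = j"
      by (simp only: mod_add_self2) auto
    then show ?thesis
      using rot_iterate_entry[OF True, of n p] by (simp only:)
  next
    case False
    then have "rot n q j = j" for q
      using assms(1) by (auto simp: rot_def)
    moreover obtain k where "n = Suc k"
      using assms(1) by (cases n) auto
    ultimately have "(rot n ^^ n) p j = j" by simp
    then show ?thesis
      using permutes_not_in[OF assms(2) False] by simp
  qed
qed

lemma map_orbit_periodic:
  assumes "(f ^^ n) x = x" and "n \<ge> 1"
  shows "map_orbit f x = (\<lambda>m. (f ^^ m) x) ` {..<n}"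
proof -
  have "(f ^^ m) x \<in> (\<lambda>m. (f ^^ m) x) ` {..<n}" for m
    using funpow_mod_eq[OF assms(1), of m] assms(2)
    by (intro image_eqI[of _ _ "m mod n"]) auto
  then show ?thesis by (auto simp: map_orbit_def)
qed

lemma bij_betw_shift_mod: "bij_betw (\<lambda>m. (k + m) mod n) {..<n} {..<n::nat}"
proof -
  have "inj_on (\<lambda>m. (k + m) mod n) {..<n}"
  proof (rule inj_onI)
    fix a b assume ab: "a \<in> {..<n}" "b \<in> {..<n}" "(k + a) mod n = (k + b) mod n"
    \<comment> \<open>Adding a complement of \<open>k\<close> modulo \<open>n\<close> undoes the shift.\<close>
    have "((k + c) mod n + (n - k mod n)) mod n = c" if "c < n" for c
    proof -
      have "((k + c) mod n + (n - k mod n)) mod n = (k mod n + c + (n - k mod n)) mod n"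
        by (metis mod_add_left_eq)
      also have "k mod n + c + (n - k mod n) = c + n"
        using that mod_less_divisor[of n k] by linarith
      finally show ?thesis using that by simp
    qed
    then show "a = b" using ab by (metis lessThan_iff)
  qed
  moreover have "(\<lambda>m. (k + m) mod n) ` {..<n} \<subseteq> {..<n}" by auto
  ultimately show ?thesis by (simp add: bij_betw_def endo_inj_surj)
qed

lemma bij_betw_rot_entry:
  assumes "i \<in> {1..n}" and "p permutes {1..n}"
  shows "bij_betw (\<lambda>m. (rot n ^^ m) p i) {..<n} {1..n}"
proof -
  have "bij_betw Suc {..<n} {1..n}"
    by (simp add: bij_betw_def image_Suc_lessThan)
  from bij_betw_trans[OF bij_betw_trans[OF bij_betw_shift_mod[of "i - 1"] this]
      permutes_imp_bij[OF assms(2)]]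
  show ?thesis
    by (simp add: rot_iterate_entry[OF assms(1)] comp_def)
qed

theorem theorem2p1:
  fixes n i :: nat
  assumes "n \<ge> 1" and "i \<in> {1..n}"
  shows "mesic (Sym n) (rot n) (\<lambda>\<pi>. real (\<pi> i)) ((real n + 1) / 2)"
  unfolding mesic_def
proof
  fix orb assume "orb \<in> map_orbit (rot n) ` Sym n"
  then obtain p where p: "p permutes {1..n}" and orb: "orb = map_orbit (rot n) p"
    by (auto simp: Sym_def)
  let ?r = "\<lambda>m. (rot n ^^ m) p"
  have orb_turn: "orb = ?r ` {..<n}"
    unfolding orb by (rule map_orbit_periodic[OF rot_full_turn[OF assms(1) p] assms(1)])
  note bij = bij_betw_rot_entry[OF assms(2) p]
  \<comment> \<open>The rotations are already told apart by their entry at position \<open>i\<close>.\<close>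
  have inj: "inj_on ?r {..<n}"
    using bij_betw_imp_inj_on[OF bij] by (auto simp: inj_on_def)
  have "(\<Sum>\<pi>\<in>orb. real (\<pi> i)) = (\<Sum>m<n. real (?r m i))"
    unfolding orb_turn by (simp add: sum.reindex[OF inj])
  also have "\<dots> = (\<Sum>k = 1..n. real k)"
    by (rule sum.reindex_bij_betw[OF bij])
  also have "\<dots> = real n * (real n + 1) / 2"
    using double_gauss_sum_from_Suc_0[of n, where 'a = real] by simp
  finally have "(\<Sum>\<pi>\<in>orb. real (\<pi> i)) = real n * (real n + 1) / 2" .
  moreover have "card orb = n"
    unfolding orb_turn by (simp add: card_image[OF inj])
  ultimately show "1 / real (card orb) * (\<Sum>\<pi>\<in>orb. real (\<pi> i)) = (real n + 1) / 2"
    using assms(1) by simp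
qed

end
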